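(* Let $T$ be a discrete random variable (the target) and let $\preceq$ be a preorder between discrete random variables (each having a joint distribution with $T$) that satisfies Kolchinsky's axioms (K1)–(K3). For sources $A_1,\dots,A_r$ define $$I_\cap(A_1,\dots,A_r) := \sup_{Q:\; Q\preceq A_i,\ i\in\{1,\dots,r\}} I(Q;T),$$ where the supremum is over discrete random variables $Q$. Then $I_\cap$ satisfies the Williams–Beer axioms, that is: 1. (Symmetry) $I_\cap(A_1,\dots,A_r)$ is symmetric in the $A_i$'s. 2. (Self-redundancy) $I_\cap(A) = I(A;T)$ for every single source $A$. 3. (Monotonicity) $I_\cap(A_1,\dots,A_{r-1},A_r)\le I_\cap(A_1,\dots,A_{r-1})$ for all $r\ge 2$ and all sources $A_1,\dots,A_r$. 4. (Equality for monotonicity) If $r\ge 2$ and $A_{r-1}\subseteq A_r$, then $I_\cap(A_1,\dots,A_{r-1},A_r)= I_\cap(A_1,\dots,A_{r-1})$.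
   Context: $I(X;Z)=\sum_{x,z}p(x,z)\log\frac{p(x,z)}{p(x)p(z)}$ is Shannon's mutual information. The target $T$ is fixed throughout. A preorder is a reflexive and transitive relation. A source $A$ is a finite nonempty set of discrete random variables (jointly distributed with each other and with $T$), e.g. $A=\{Y_1,Y_2\}$. It is identified with the joint (tuple-valued) discrete random variable formed by its elements, e.g. $(Y_1,Y_2)$; the order and nesting of the components of a tuple are immaterial, so that for $A\subseteq B$ the variable $B$ is identified with $(A, B\setminus A)$. Inclusion $A_{r-1}\subseteq A_r$ is inclusion of sets of random variables. Kolchinsky's axioms for $\preceq$ (with respect to $T$), required for all discrete random variables in question: (K1) Monotonicity of mutual information with respect to $T$: $Y_i\preceq Y_j \Rightarrow I(Y_i;T)\le I(Y_j;T)$. (K2) Reflexivity: $Y_i\preceq Y_i$ for all $Y_i$. (K3) For any finite collection $Y_1,\dots,Y_n$ of jointly distributed variables and any $i$, $C\preceq Y_i\preceq (Y_1,\dots,Y_n)$, where $C$ is any variable taking a constant value with probability one. *)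

theory Defs
  imports "HOL-Probability.Probability"
begin

definition discrete_rv :: "'w measure \<Rightarrow> ('w \<Rightarrow> 'v) \<Rightarrow> bool" where
  "discrete_rv M X \<longleftrightarrow> X \<in> measurable M (count_space UNIV) \<and> countable (X ` space M)"

definition pmass :: "'w measure \<Rightarrow> ('w \<Rightarrow> 'v) \<Rightarrow> 'v \<Rightarrow> real" where
  "pmass M X x = measure M (X -` {x} \<inter> space M)"

text \<open>
  Shannon's formula, with logarithm to base \<open>b\<close>. For countable alphabets the mutual information
  may be infinite. The sum is therefore taken in \<^typ>\<open>ereal\<close>: its negative terms are summable,
  so the unordered sum always converges in \<^typ>\<open>ereal\<close>. The library's real-valued
  \<^const>\<open>prob_space.mutual_information\<close> is 0 when the integral diverges. For
  finite alphabets the two agree (lemma \<open>mutual_info_eq_library\<close> below). Terms with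
  \<open>p(x,z) = 0\<close> vanish.
\<close>

definition mutual_info :: "real \<Rightarrow> 'w measure \<Rightarrow> ('w \<Rightarrow> 'a) \<Rightarrow> ('w \<Rightarrow> 'b) \<Rightarrow> ereal" where
  "mutual_info b M X Z =
     (\<Sum>\<^sub>\<infinity>(x, z)\<in>UNIV. ereal (pmass M (\<lambda>w. (X w, Z w)) (x, z) *
        log b (pmass M (\<lambda>w. (X w, Z w)) (x, z) / (pmass M X x * pmass M Z z))))"

lemma (in information_space) mutual_info_eq_library:
  assumes X: "simple_function M X" and Z: "simple_function M Z"
  shows "mutual_info b M X Z =
    ereal (mutual_information b (count_space (X ` space M)) (count_space (Z ` space M)) X Z)"
proof -
  have XZ: "simple_function M (\<lambda>w. (X w, Z w))"
    using X Z by (rule simple_function_Pair)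
  let ?S = "(\<lambda>w. (X w, Z w)) ` space M"
  let ?p = "pmass M (\<lambda>w. (X w, Z w))"
  let ?f = "\<lambda>(x, z). ?p (x, z) * log b (?p (x, z) / (pmass M X x * pmass M Z z))"
  have sd2: "simple_distributed M Z (pmass M Z)"
    using Z by (intro simple_distributedI) (auto simp: pmass_def)
  have sd3: "simple_distributed M (\<lambda>w. (X w, Z w)) ?p"
    using XZ by (intro simple_distributedI) (auto simp: pmass_def)
  have sd1: "simple_distributed M X (pmass M X)"
    using X by (intro simple_distributedI) (auto simp: pmass_def)
  have zero: "?p q = 0" if "q \<notin> ?S" for q
  proof -
    have "(\<lambda>w. (X w, Z w)) -` {q} \<inter> space M = {}"
      using that by auto
    then show ?thesis
      by (simp add: pmass_def)
  qed
  have fin: "finite ?S"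
    using XZ by (rule simple_functionD)
  have "mutual_info b M X Z = infsum (\<lambda>q. ereal (?f q)) UNIV"
    unfolding mutual_info_def by (intro infsum_cong) auto
  also have "\<dots> = infsum (\<lambda>q. ereal (?f q)) ?S"
    by (intro infsum_cong_neutral) (auto simp: zero zero_ereal_def)
  also have "\<dots> = ereal (sum ?f ?S)"
    using fin by simp
  also have "sum ?f ?S =
    mutual_information b (count_space (X ` space M)) (count_space (Z ` space M)) X Z"
    using mutual_information_simple_distributed[OF sd1 sd2 sd3] by simp
  finally show ?thesis .
qed

text \<open>
  A setting \<open>(M, T')\<close> is a probability space together with a copy \<open>T'\<close> of the fixed target
  \<open>T\<close> on it, so that variables on \<open>M\<close> have a joint distribution with \<open>T\<close>. Two variables are
  jointly distributed with each other if they live in the same setting.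
\<close>

type_synonym ('w, 't) setting = "'w measure \<times> ('w \<Rightarrow> 't)"

definition target_settings :: "'w0 measure \<Rightarrow> ('w0 \<Rightarrow> 't) \<Rightarrow> ('w, 't) setting set" where
  "target_settings P T = {(M, T'). prob_space M \<and> discrete_rv M T' \<and>
     distr M (count_space UNIV) T' = distr P (count_space UNIV) T}"

text \<open>
  A (possibly tuple-valued) discrete random variable is a setting with a finite nonempty set of
  elementary variables on it. The set \<open>{Y}\<close> stands for \<open>Y\<close> itself. Sources are exactly these
  objects. Since the order and nesting of components are immaterial, the tuple formed from the
  variables \<open>A\<^sub>1, \<dots>, A\<^sub>n\<close> is their union.
\<close>

type_synonym ('w, 't, 'v) rvar = "('w, 't) setting \<times> ('w \<Rightarrow> 'v) set"

definition rvars :: "('w, 't) setting set \<Rightarrow> ('w, 't, 'v) rvar set" where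
  "rvars S = {((M, T'), A). (M, T') \<in> S \<and> finite A \<and> A \<noteq> {} \<and> (\<forall>Y\<in>A. discrete_rv M Y)}"

definition joint_value :: "('w \<Rightarrow> 'v) set \<Rightarrow> 'w \<Rightarrow> (('w \<Rightarrow> 'v) \<Rightarrow> 'v)" where
  "joint_value A w = (\<lambda>Y\<in>A. Y w)"

lemma discrete_rv_joint_value:
  assumes fin: "finite A" and rv: "\<And>Y. Y \<in> A \<Longrightarrow> discrete_rv M Y"
  shows "discrete_rv M (joint_value A)"
proof -
  have "joint_value A ` space M \<subseteq> (\<Pi>\<^sub>E Y\<in>A. Y ` space M)"
    by (auto simp: joint_value_def)
  moreover have "countable (\<Pi>\<^sub>E Y\<in>A. Y ` space M)"
    using fin rv by (intro countable_PiE) (auto simp: discrete_rv_def)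
  ultimately have cnt: "countable (joint_value A ` space M)"
    by (rule countable_subset)
  have single: "joint_value A -` {f} \<inter> space M \<in> sets M" for f
  proof (cases "f \<in> extensional A")
    case True
    have "joint_value A -` {f} \<inter> space M = {w \<in> space M. \<forall>Y\<in>A. w \<in> Y -` {f Y} \<inter> space M}"
      using True by (auto simp: joint_value_def fun_eq_iff extensional_def)
    also have "\<dots> \<in> sets M"
    proof (rule sets.sets_Collect_finite_All[OF _ fin])
      fix Y assume "Y \<in> A"
      then have "Y -` {f Y} \<inter> space M \<in> sets M"
        using rv[of Y] by (intro measurable_sets) (auto simp: discrete_rv_def)
      moreover have "{w \<in> space M. w \<in> Y -` {f Y} \<inter> space M} = Y -` {f Y} \<inter> space M"
        by auto
      ultimately show "{w \<in> space M. w \<in> Y -` {f Y} \<inter> space M} \<in> sets M"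
        by simp
    qed
    finally show ?thesis .
  next
    case False
    then have "joint_value A -` {f} \<inter> space M = {}"
      by (auto simp: joint_value_def)
    then show ?thesis by simp
  qed
  have "joint_value A -` F \<inter> space M \<in> sets M" for F
  proof -
    have "joint_value A -` F \<inter> space M =
      (\<Union>f\<in>F \<inter> joint_value A ` space M. joint_value A -` {f} \<inter> space M)"
      by auto
    also have "\<dots> \<in> sets M"
      using cnt single by (intro sets.countable_UN') (auto intro: countable_subset)
    finally show ?thesis .
  qed
  then show ?thesis
    using cnt by (auto simp: discrete_rv_def measurable_def)
qed

fun target_info :: "real \<Rightarrow> ('w, 't, 'v) rvar \<Rightarrow> ereal" where
  "target_info b ((M, T'), A) = mutual_info b M (joint_value A) T'"

fun constant_rvar :: "('w, 't, 'v) rvar \<Rightarrow> bool" where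
  "constant_rvar ((M, T'), A) \<longleftrightarrow> (\<exists>c. AE w in M. joint_value A w = c)"

definition kolchinsky_K1 ::
  "real \<Rightarrow> ('w, 't) setting set \<Rightarrow> (('w, 't, 'v) rvar \<Rightarrow> ('w, 't, 'v) rvar \<Rightarrow> bool) \<Rightarrow> bool" where
  "kolchinsky_K1 b S le \<longleftrightarrow>
     (\<forall>X\<in>rvars S. \<forall>Y\<in>rvars S. le X Y \<longrightarrow> target_info b X \<le> target_info b Y)"

definition kolchinsky_K2 ::
  "('w, 't) setting set \<Rightarrow> (('w, 't, 'v) rvar \<Rightarrow> ('w, 't, 'v) rvar \<Rightarrow> bool) \<Rightarrow> bool" where
  "kolchinsky_K2 S le \<longleftrightarrow> (\<forall>X\<in>rvars S. le X X)"

definition kolchinsky_K3 ::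
  "('w, 't) setting set \<Rightarrow> (('w, 't, 'v) rvar \<Rightarrow> ('w, 't, 'v) rvar \<Rightarrow> bool) \<Rightarrow> bool" where
  "kolchinsky_K3 S le \<longleftrightarrow>
     (\<forall>s \<Y>. finite \<Y> \<longrightarrow> (\<forall>A\<in>\<Y>. (s, A) \<in> rvars S) \<longrightarrow>
        (\<forall>A\<in>\<Y>. (\<forall>C\<in>rvars S. constant_rvar C \<longrightarrow> le C (s, A)) \<and> le (s, A) (s, \<Union>\<Y>)))"

definition kolchinsky_axioms ::
  "real \<Rightarrow> ('w, 't) setting set \<Rightarrow> (('w, 't, 'v) rvar \<Rightarrow> ('w, 't, 'v) rvar \<Rightarrow> bool) \<Rightarrow> bool" where
  "kolchinsky_axioms b S le \<longleftrightarrow> kolchinsky_K1 b S le \<and> kolchinsky_K2 S le \<and> kolchinsky_K3 S le"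

definition I_cap ::
  "real \<Rightarrow> ('w, 't) setting set \<Rightarrow> (('w, 't, 'v) rvar \<Rightarrow> ('w, 't, 'v) rvar \<Rightarrow> bool) \<Rightarrow>
   ('w, 't, 'v) rvar list \<Rightarrow> ereal" where
  "I_cap b S le As =
     (SUP Q\<in>{Q \<in> rvars S. \<forall>i<length As. le Q (As ! i)}. target_info b Q)"

definition source_subset :: "('w, 't, 'v) rvar \<Rightarrow> ('w, 't, 'v) rvar \<Rightarrow> bool" where
  "source_subset A B \<longleftrightarrow> fst A = fst B \<and> snd A \<subseteq> snd B"

end

theory Submission
  imports Defs
begin

text \<open>\<open>I_cap\<close> depends only on the set of common lower bounds of the listed
  sources, hence only on the set of these sources (\<open>I_cap_eq_set\<close>). This gives symmetry
  at once, and monotonicity because a further source can only shrink the set of lower bounds. For a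
  single source, K2 makes the source itself a candidate and K1 makes it an optimal one. Equality
  under inclusion rests on \<open>source_subset_imp_le\<close>, which turns inclusion into
  \<open>le\<close> by K3, and on \<open>I_cap_append_upper\<close>, where transitivity shows that
  the larger source excludes no candidate.\<close>

lemma I_cap_eq_set:
  "I_cap b S le As = (SUP Q\<in>{Q \<in> rvars S. \<forall>A\<in>set As. le Q A}. target_info b Q)"
  unfolding I_cap_def by (simp only: all_set_conv_all_nth)

lemma I_cap_append_le: "I_cap b S le (As @ Bs) \<le> I_cap b S le As"
  unfolding I_cap_eq_set by (rule SUP_subset_mono) auto

text \<open>The supremum is attained at \<open>Q = A\<close>: K1 bounds every candidate by
  \<open>A\<close>, and K2 admits \<open>A\<close> as a candidate.\<close>

lemma I_cap_singleton:
  assumes "kolchinsky_K1 b S le" and "kolchinsky_K2 S le" and A: "A \<in> rvars S"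
  shows "I_cap b S le [A] = target_info b A"
proof (rule antisym)
  show "I_cap b S le [A] \<le> target_info b A"
    unfolding I_cap_eq_set using assms by (intro SUP_least) (auto simp: kolchinsky_K1_def)
  show "target_info b A \<le> I_cap b S le [A]"
    unfolding I_cap_eq_set using assms by (intro SUP_upper) (auto simp: kolchinsky_K2_def)
qed

lemma source_subset_imp_le:
  assumes K3: "kolchinsky_K3 S le" and "A \<in> rvars S" and "B \<in> rvars S"
    and sub: "source_subset A B"
  shows "le A B"
proof -
  obtain s A' B' where AB: "A = (s, A')" "B = (s, B')" and "A' \<subseteq> B'"
    using sub by (metis prod.collapse source_subset_def)
  \<comment> \<open>A tuple is encoded as a union, so the tuple formed from \<open>A'\<close> and
    \<open>B'\<close> is \<open>B'\<close> itself; K3 for this pair then puts the component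
    \<open>A'\<close> below it.\<close>
  then have "\<Union>{A', B'} = B'"
    by auto
  moreover have "le (s, A') (s, \<Union>{A', B'})"
    using K3[unfolded kolchinsky_K3_def, rule_format, of "{A', B'}" s A'] assms(2,3) AB by auto
  ultimately show ?thesis
    using AB by simp
qed

text \<open>Any \<open>Q\<close> below all of \<open>As\<close> is below \<open>A\<close>, hence
  below \<open>B\<close> by transitivity. Both suprema therefore range over the same set of
  \<open>Q\<close>.\<close>

lemma I_cap_append_upper:
  assumes trans: "transp_on (rvars S) le"
    and "set As \<subseteq> rvars S" and "A \<in> set As" and "B \<in> rvars S" and "le A B"
  shows "I_cap b S le (As @ [B]) = I_cap b S le As"
proof -
  have "le Q B" if "Q \<in> rvars S" "\<forall>A\<in>set As. le Q A" for Q
    using transp_onD[OF trans, of Q A B] that assms by auto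
  then have "{Q \<in> rvars S. \<forall>A\<in>set (As @ [B]). le Q A} = {Q \<in> rvars S. \<forall>A\<in>set As. le Q A}"
    by auto
  then show ?thesis
    by (simp only: I_cap_eq_set)
qed

theorem theorem1:
  fixes b :: real
    and P :: "'w0 measure" and T :: "'w0 \<Rightarrow> 't"
    and S :: "('w, 't) setting set"
    and le :: "('w, 't, 'v) rvar \<Rightarrow> ('w, 't, 'v) rvar \<Rightarrow> bool"
  assumes "b > 1"
    and "prob_space P" and "discrete_rv P T"
    and "S \<subseteq> target_settings P T"
    and "reflp_on (rvars S) le" and "transp_on (rvars S) le"
    and "kolchinsky_axioms b S le"
  shows
    "(\<forall>As Bs. As \<noteq> [] \<longrightarrow> set As \<subseteq> rvars S \<longrightarrow> mset Bs = mset As \<longrightarrow>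
        I_cap b S le Bs = I_cap b S le As) \<and>
     (\<forall>A\<in>rvars S. I_cap b S le [A] = target_info b A) \<and>
     (\<forall>As. \<forall>B\<in>rvars S. As \<noteq> [] \<longrightarrow> set As \<subseteq> rvars S \<longrightarrow>
        I_cap b S le (As @ [B]) \<le> I_cap b S le As) \<and>
     (\<forall>As. \<forall>B\<in>rvars S. As \<noteq> [] \<longrightarrow> set As \<subseteq> rvars S \<longrightarrow> source_subset (last As) B \<longrightarrow>
        I_cap b S le (As @ [B]) = I_cap b S le As)"
proof (intro conjI allI ballI impI)
  have K: "kolchinsky_K1 b S le" "kolchinsky_K2 S le" "kolchinsky_K3 S le"
    using assms(7) by (auto simp: kolchinsky_axioms_def)
  show "I_cap b S le Bs = I_cap b S le As" if "mset Bs = mset As" for As Bs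
    using mset_eq_setD[OF that] by (simp only: I_cap_eq_set)
  show "I_cap b S le [A] = target_info b A" if "A \<in> rvars S" for A
    using K(1,2) that by (rule I_cap_singleton)
  show "I_cap b S le (As @ [B]) \<le> I_cap b S le As" for As B
    by (rule I_cap_append_le)
  show "I_cap b S le (As @ [B]) = I_cap b S le As"
    if "B \<in> rvars S" "As \<noteq> []" "set As \<subseteq> rvars S" "source_subset (last As) B" for As B
  proof (rule I_cap_append_upper[OF assms(6)])
    show last: "last As \<in> set As"
      using that by simp
    show "le (last As) B"
      using last that by (intro source_subset_imp_le[OF K(3)]) blast+
  qed (use that in blast)+
qed

end
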